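(* Let $k\in\{3,4,5\}$ and consider the $k$-step extrapolated BDF (EBDF) method, with coefficients $a_j$ ($1\le j\le k$) and $b_j$ ($0\le j\le k$). Let $(\tau_n)_{n\in\mathbb{Z}}$ be the associated sequence, defined by $\tau_n=0$ for $n<0$, $\tau_n=b_n+\sum_{j=1}^k a_j\tau_{n-j}$ for $0\le n\le k$, and $\tau_n=\sum_{j=1}^k a_j\tau_{n-j}$ for $n>k$, and let $n_0:=\min\{n:\ 1\le n\le k \text{ and } \tau_n\neq 0\}$. Then $n_0=1$ and $\tau_n>0$ for all integers $n\ge n_0=1$.
   Context: A linear multistep method with $k$ steps has the form $u_n=\sum_{j=1}^k a_j u_{n-j}+\Delta t\sum_{j=0}^k b_jF(u_{n-j})$ for $n\ge k$. The $k$-step EBDF method has coefficients $b_0=0$ and, for $1\le j\le k$, $$a_j=\frac{(-1)^{j-1}}{j\,H_k}\binom{k}{j},\qquad b_j=\frac{(-1)^{j-1}}{H_k}\binom{k}{j},\qquad H_k=\sum_{i=1}^k\frac1i .$$ Explicitly: $k=3$: $(a_1,a_2,a_3)=\frac1{11}(18,-9,2)$, $(b_1,b_2,b_3)=\frac{6}{11}(3,-3,1)$; $k=4$: $(a_1,\dots,a_4)=\frac1{25}(48,-36,16,-3)$, $(b_1,\dots,b_4)=\frac{12}{25}(4,-6,4,-1)$; $k=5$: $(a_1,\dots,a_5)=\frac1{137}(300,-300,200,-75,12)$, $(b_1,\dots,b_5)=\frac{60}{137}(5,-10,10,-5,1)$. *)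

theory Defs
  imports "HOL-Analysis.Harmonic_Numbers"
begin

text \<open>
  A \<open>k\<close>-step linear multistep method
  \<open>u n = (\<Sum>j=1..k. a j * u (n - j)) + \<Delta>t * (\<Sum>j=0..k. b j * F (u (n - j)))\<close>
  is given by its coefficient functions \<open>a\<close> (read at \<open>1 \<le> j \<le> k\<close>) and \<open>b\<close> (read at \<open>0 \<le> j \<le> k\<close>).
\<close>

function lmm_tau :: "nat \<Rightarrow> (nat \<Rightarrow> real) \<Rightarrow> (nat \<Rightarrow> real) \<Rightarrow> int \<Rightarrow> real" where
  "lmm_tau k a b n =
    (if n < 0 then 0
     else if n \<le> int k then b (nat n) + (\<Sum>j = 1..k. a j * lmm_tau k a b (n - int j))
     else (\<Sum>j = 1..k. a j * lmm_tau k a b (n - int j)))"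
  by pat_completeness auto
termination
  by (relation "measure (\<lambda>(k, a, b, n). nat (n + 1))") auto

declare lmm_tau.simps [simp del]

text \<open>\<open>Min\<close> of the empty set is unspecified: \<open>lmm_n0\<close> is meaningful
  only if \<open>lmm_tau k a b n \<noteq> 0\<close> for some \<open>1 \<le> n \<le> k\<close>.\<close>

definition lmm_n0 :: "nat \<Rightarrow> (nat \<Rightarrow> real) \<Rightarrow> (nat \<Rightarrow> real) \<Rightarrow> int" where
  "lmm_n0 k a b = Min {n. 1 \<le> n \<and> n \<le> int k \<and> lmm_tau k a b n \<noteq> 0}"

definition ebdf_a :: "nat \<Rightarrow> nat \<Rightarrow> real" where
  "ebdf_a k j = (- 1) ^ (j - 1) / (real j * harm k) * real (k choose j)"

definition ebdf_b :: "nat \<Rightarrow> nat \<Rightarrow> real" where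
  "ebdf_b k j = (if j = 0 then 0 else (- 1) ^ (j - 1) / harm k * real (k choose j))"

lemma ebdf_a_values:
  "map (ebdf_a 3) [1..<4] = map (\<lambda>x. x / 11) [18, - 9, 2]"
  "map (ebdf_a 4) [1..<5] = map (\<lambda>x. x / 25) [48, - 36, 16, - 3]"
  "map (ebdf_a 5) [1..<6] = map (\<lambda>x. x / 137) [300, - 300, 200, - 75, 12]"
  by (simp_all add: ebdf_a_def harm_def upt_rec numeral_eq_Suc field_simps)

lemma ebdf_b_values:
  "map (ebdf_b 3) [0..<4] = map (\<lambda>x. 6 / 11 * x) [0, 3, - 3, 1]"
  "map (ebdf_b 4) [0..<5] = map (\<lambda>x. 12 / 25 * x) [0, 4, - 6, 4, - 1]"
  "map (ebdf_b 5) [0..<6] = map (\<lambda>x. 60 / 137 * x) [0, 5, - 10, 10, - 5, 1]"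
  by (simp_all add: ebdf_b_def harm_def upt_rec numeral_eq_Suc field_simps)

end

theory Submission
  imports Defs
begin

text \<open>
  Write \<open>A(z) = 1 - (\<Sum>j=1..k. a j * z^j)\<close>. Consistency of the method gives the factorization
  \<open>A(z) = (1 - z) * Q(z)\<close> and, as the roots of \<open>Q\<close> lie outside the closed unit disc, the limit \<open>1\<close>
  of \<open>\<tau>\<close>. So \<open>\<tau>\<close> should be compared with its limit: the claim is that \<open>e n = \<tau> n - 1\<close>
  satisfies \<open>\<bar>e n\<bar> < 1\<close> for all \<open>n \<ge> 2\<close>. The value at \<open>n = 1\<close> is \<open>b 1 > 0\<close>, and is treated apart,
  since it exceeds \<open>2\<close> for
  \<open>k = 5\<close>.

  The recurrence of \<open>\<tau>\<close> says that the combination of consecutive values of \<open>\<tau>\<close> with the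
  coefficients of \<open>Q\<close> is independent of the position; its value, found from the first terms, is \<open>Q(1)\<close>,
  as it is for the constant sequence \<open>1\<close>. Hence \<open>e\<close> is
  annihilated by \<open>Q\<close>, and so by every multiple of \<open>Q\<close>. By the location of the
  roots, some multiple \<open>1 - (\<Sum>j=1..m. r j * z^j)\<close> satisfies \<open>(\<Sum>j=1..m. \<bar>r j\<bar>) \<le> 1\<close>, and with such a
  multiple the bound \<open>\<bar>e n\<bar> < 1\<close> passes from any \<open>m\<close> consecutive indices to all later ones
  (\<open>recurrence_preserves_abs_less_1\<close>). Small multiples suffice (each up to a constant factor):
  \<^item> \<open>k = 3\<close>: \<open>11 - 7 z + 2 z\<^sup>2\<close>, which is \<open>Q\<close> itself;
  \<^item> \<open>k = 4\<close>: \<open>(25 - 23 z + 13 z\<^sup>2 - 3 z\<^sup>3) (1 + z) = 25 + 2 z - 10 z\<^sup>2 + 10 z\<^sup>3 - 3 z\<^sup>4\<close>;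
  \<^item> \<open>k = 5\<close>: \<open>(137 - 163 z + 137 z\<^sup>2 - 63 z\<^sup>3 + 12 z\<^sup>4) (2 + 2 z + z\<^sup>2)
      = 274 - 52 z + 85 z\<^sup>2 - 15 z\<^sup>3 + 35 z\<^sup>4 - 39 z\<^sup>5 + 12 z\<^sup>6\<close>.

  The first \<open>m\<close> values from index \<open>2\<close> on are computed.
\<close>

section \<open>Propagation of a bound by a linear recurrence\<close>

text \<open>
  The right-hand side of the recurrence is at most \<open>(\<Sum>j=1..m. \<bar>r j\<bar>) \<le> 1\<close> times the largest modulus in
  the preceding window. That this window is finite keeps the inequality strict even if the sum
  equals \<open>1\<close>, as it does for the multiple used with \<open>k = 4\<close>.
\<close>

lemma recurrence_preserves_abs_less_1:
  fixes e r :: "nat \<Rightarrow> real"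
  assumes rec: "\<And>n. N + m \<le> n \<Longrightarrow> e n = (\<Sum>j = 1..m. r j * e (n - j))"
    and r: "(\<Sum>j = 1..m. \<bar>r j\<bar>) \<le> 1"
    and init: "\<And>n. N \<le> n \<Longrightarrow> n < N + m \<Longrightarrow> \<bar>e n\<bar> < 1"
    and "N \<le> n"
  shows "\<bar>e n\<bar> < 1"
  using \<open>N \<le> n\<close>
proof (induction n rule: less_induct)
  case (less n)
  show ?case
  proof (cases "n < N + m")
    case True
    then show ?thesis using init less.prems by blast
  next
    case False
    define M where "M = Max (insert 0 ((\<lambda>j. \<bar>e (n - j)\<bar>) ` {1..m}))"
    have M: "0 \<le> M" "\<And>j. j \<in> {1..m} \<Longrightarrow> \<bar>e (n - j)\<bar> \<le> M"
      unfolding M_def by (rule Max_ge; simp)+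
    have "\<bar>e (n - j)\<bar> < 1" if "j \<in> {1..m}" for j
      using less.IH[of "n - j"] False that by auto
    then have "M < 1"
      unfolding M_def by simp
    have "\<bar>e n\<bar> \<le> (\<Sum>j = 1..m. \<bar>r j\<bar> * \<bar>e (n - j)\<bar>)"
      using rec[of n] False sum_abs[of "\<lambda>j. r j * e (n - j)" "{1..m}"] by (simp add: abs_mult)
    also have "\<dots> \<le> (\<Sum>j = 1..m. \<bar>r j\<bar> * M)"
      using M by (intro sum_mono mult_left_mono) auto
    also have "\<dots> = (\<Sum>j = 1..m. \<bar>r j\<bar>) * M"
      by (simp add: sum_distrib_right)
    also have "\<dots> \<le> M"
      using r M(1) mult_right_mono by fastforce
    finally show ?thesis using \<open>M < 1\<close> by simp
  qed
qed

section \<open>The sequence on the natural numbers\<close>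

lemma lmm_tau_nat:
  "lmm_tau k a b (int n) =
    (if n \<le> k then b n else 0) + (\<Sum>j = 1..k. if j \<le> n then a j * lmm_tau k a b (int (n - j)) else 0)"
proof -
  have neg: "lmm_tau k a b i = 0" if "i < 0" for i
    using that by (simp add: lmm_tau.simps)
  have "(\<Sum>j = 1..k. a j * lmm_tau k a b (int n - int j)) =
      (\<Sum>j = 1..k. if j \<le> n then a j * lmm_tau k a b (int (n - j)) else 0)"
    by (intro sum.cong) (auto simp: neg of_nat_diff)
  then show ?thesis
    using lmm_tau.simps[of k a b "int n"]
    by (auto simp only: nat_int of_nat_less_0_iff of_nat_le_iff add_0 split: if_split)
qed

definition ebdf_tau :: "nat \<Rightarrow> nat \<Rightarrow> real" where
  "ebdf_tau k n = lmm_tau k (ebdf_a k) (ebdf_b k) (int n)"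

lemma ebdf_tau_rec:
  "ebdf_tau k n =
    (if n \<le> k then ebdf_b k n else 0) + (\<Sum>j = 1..k. if j \<le> n then ebdf_a k j * ebdf_tau k (n - j) else 0)"
  unfolding ebdf_tau_def by (rule lmm_tau_nat)

lemma ebdf_coeffs_3:
  "ebdf_a 3 1 = 18/11" "ebdf_a 3 2 = -9/11" "ebdf_a 3 3 = 2/11"
  "ebdf_b 3 0 = 0" "ebdf_b 3 1 = 18/11" "ebdf_b 3 2 = -18/11" "ebdf_b 3 3 = 6/11"
  using ebdf_a_values(1) ebdf_b_values(1) by (simp_all add: upt_rec numeral_eq_Suc)

lemma ebdf_coeffs_4:
  "ebdf_a 4 1 = 48/25" "ebdf_a 4 2 = -36/25" "ebdf_a 4 3 = 16/25" "ebdf_a 4 4 = -3/25"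
  "ebdf_b 4 0 = 0" "ebdf_b 4 1 = 48/25" "ebdf_b 4 2 = -72/25" "ebdf_b 4 3 = 48/25"
  "ebdf_b 4 4 = -12/25"
  using ebdf_a_values(2) ebdf_b_values(2) by (simp_all add: upt_rec numeral_eq_Suc)

lemma ebdf_coeffs_5:
  "ebdf_a 5 1 = 300/137" "ebdf_a 5 2 = -300/137" "ebdf_a 5 3 = 200/137" "ebdf_a 5 4 = -75/137"
  "ebdf_a 5 5 = 12/137"
  "ebdf_b 5 0 = 0" "ebdf_b 5 1 = 300/137" "ebdf_b 5 2 = -600/137" "ebdf_b 5 3 = 600/137"
  "ebdf_b 5 4 = -300/137" "ebdf_b 5 5 = 60/137"
  using ebdf_a_values(3) ebdf_b_values(3) by (simp_all add: upt_rec numeral_eq_Suc)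

lemma sum_1_to_numeral:
  fixes f :: "nat \<Rightarrow> real"
  shows "(\<Sum>j = 1..2. f j) = f 1 + f 2"
    "(\<Sum>j = 1..3. f j) = f 1 + f 2 + f 3"
    "(\<Sum>j = 1..4. f j) = f 1 + f 2 + f 3 + f 4"
    "(\<Sum>j = 1..5. f j) = f 1 + f 2 + f 3 + f 4 + f 5"
    "(\<Sum>j = 1..6. f j) = f 1 + f 2 + f 3 + f 4 + f 5 + f 6"
  by (simp_all add: numeral_eq_Suc)

section \<open>Distance of the sequence from its limit\<close>

lemma ebdf_tau_3_start:
  "ebdf_tau 3 0 = 0"
  "ebdf_tau 3 1 = 18/11"
  "ebdf_tau 3 2 = 126/121"
  "ebdf_tau 3 3 = 1212/1331"
proof -
  note rec = ebdf_tau_rec[of 3, unfolded sum_1_to_numeral ebdf_coeffs_3]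
  show v0: "ebdf_tau 3 0 = 0" using rec[of 0] ebdf_coeffs_3 by simp
  show v1: "ebdf_tau 3 1 = 18/11" using rec[of 1] v0 ebdf_coeffs_3 by simp
  show v2: "ebdf_tau 3 2 = 126/121" using rec[of 2] v0 v1 ebdf_coeffs_3 by simp
  show v3: "ebdf_tau 3 3 = 1212/1331" using rec[of 3] v0 v1 v2 ebdf_coeffs_3 by simp
qed

lemma ebdf_tau_3_homogeneous:
  assumes "4 \<le> n"
  shows "11 * ebdf_tau 3 n =
    18 * ebdf_tau 3 (n - 1) - 9 * ebdf_tau 3 (n - 2) + 2 * ebdf_tau 3 (n - 3)"
  using assms ebdf_tau_rec[of 3 n, unfolded sum_1_to_numeral ebdf_coeffs_3] by simp

text \<open>
  The difference of the left-hand side at consecutive indices is the recurrence, because the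
  coefficients on the left are those of the quotient of \<open>11 - 18 z + 9 z\<^sup>2 - 2 z\<^sup>3\<close> by \<open>1 - z\<close>.
\<close>

lemma ebdf_tau_3_conserved:
  assumes "3 \<le> n"
  shows "11 * ebdf_tau 3 n - 7 * ebdf_tau 3 (n - 1) + 2 * ebdf_tau 3 (n - 2) = 6"
  using assms
proof (induction n rule: dec_induct)
  case base
  show ?case using ebdf_tau_3_start by simp
next
  case (step n)
  have "Suc n - 2 = n - 1" "Suc n - 3 = n - 2" by simp_all
  then show ?case
    using step ebdf_tau_3_homogeneous[of "Suc n"] by simp
qed

text \<open>
  The conserved quantity of the constant \<open>1\<close> is \<open>11 - 7 + 2 = 6\<close>, so \<open>\<tau> - 1\<close> satisfies the
  homogeneous recurrence, whose coefficients have absolute sum \<open>9/11\<close>.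
\<close>

lemma ebdf_tau_3_near_1:
  assumes "2 \<le> n"
  shows "\<bar>ebdf_tau 3 n - 1\<bar> < 1"
proof (rule recurrence_preserves_abs_less_1[OF _ _ _ assms, where m = 2])
  \<comment> \<open>The summation starts at \<open>j = 1\<close>; the entry at index \<open>0\<close> is a placeholder.\<close>
  let ?r = "(!) [0::real, 7/11, -2/11]"
  show "(\<Sum>j = 1..2. \<bar>?r j\<bar>) \<le> 1"
    unfolding sum_1_to_numeral by simp
  show "ebdf_tau 3 n - 1 = (\<Sum>j = 1..2. ?r j * (ebdf_tau 3 (n - j) - 1))" if "2 + 2 \<le> n" for n
  proof -
    have "11 * ebdf_tau 3 n - 7 * ebdf_tau 3 (n - 1) + 2 * ebdf_tau 3 (n - 2) = 6"
      using ebdf_tau_3_conserved[of n] that by simp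
    then show ?thesis
      unfolding sum_1_to_numeral by (simp add: field_simps)
  qed
  show "\<bar>ebdf_tau 3 n - 1\<bar> < 1" if "2 \<le> n" "n < 2 + 2" for n
  proof -
    have "n = 2 \<or> n = 3" using that by linarith
    then show ?thesis using ebdf_tau_3_start by auto
  qed
qed

lemma ebdf_tau_4_start:
  "ebdf_tau 4 0 = 0"
  "ebdf_tau 4 1 = 48/25"
  "ebdf_tau 4 2 = 504/625"
  "ebdf_tau 4 3 = 10992/15625"
  "ebdf_tau 4 4 = 366516/390625"
proof -
  note rec = ebdf_tau_rec[of 4, unfolded sum_1_to_numeral ebdf_coeffs_4]
  show v0: "ebdf_tau 4 0 = 0" using rec[of 0] ebdf_coeffs_4 by simp
  show v1: "ebdf_tau 4 1 = 48/25" using rec[of 1] v0 ebdf_coeffs_4 by simp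
  show v2: "ebdf_tau 4 2 = 504/625" using rec[of 2] v0 v1 ebdf_coeffs_4 by simp
  show v3: "ebdf_tau 4 3 = 10992/15625" using rec[of 3] v0 v1 v2 ebdf_coeffs_4 by simp
  show v4: "ebdf_tau 4 4 = 366516/390625" using rec[of 4] v0 v1 v2 v3 ebdf_coeffs_4 by simp
qed

lemma ebdf_tau_4_homogeneous:
  assumes "5 \<le> n"
  shows "25 * ebdf_tau 4 n =
    48 * ebdf_tau 4 (n - 1) - 36 * ebdf_tau 4 (n - 2) + 16 * ebdf_tau 4 (n - 3) - 3 * ebdf_tau 4 (n - 4)"
  using assms ebdf_tau_rec[of 4 n, unfolded sum_1_to_numeral ebdf_coeffs_4] by simp

lemma ebdf_tau_4_conserved:
  assumes "4 \<le> n"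
  shows "25 * ebdf_tau 4 n - 23 * ebdf_tau 4 (n - 1) + 13 * ebdf_tau 4 (n - 2) - 3 * ebdf_tau 4 (n - 3) = 12"
  using assms
proof (induction n rule: dec_induct)
  case base
  show ?case using ebdf_tau_4_start by simp
next
  case (step n)
  have "Suc n - 2 = n - 1" "Suc n - 3 = n - 2" "Suc n - 4 = n - 3" by simp_all
  then show ?case
    using step ebdf_tau_4_homogeneous[of "Suc n"] by simp
qed

text \<open>
  Here the conserved quantity alone gives a recurrence with absolute sum \<open>39/25\<close>. Adding its instance at
  \<open>n - 1\<close>, that is, multiplying by \<open>1 + z\<close>, lowers the sum to exactly \<open>1\<close>.
\<close>

lemma ebdf_tau_4_near_1:
  assumes "2 \<le> n"
  shows "\<bar>ebdf_tau 4 n - 1\<bar> < 1"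
proof (rule recurrence_preserves_abs_less_1[OF _ _ _ assms, where m = 4])
  let ?r = "(!) [0::real, -2/25, 10/25, -10/25, 3/25]"
  show "(\<Sum>j = 1..4. \<bar>?r j\<bar>) \<le> 1"
    unfolding sum_1_to_numeral by simp
  show "ebdf_tau 4 n - 1 = (\<Sum>j = 1..4. ?r j * (ebdf_tau 4 (n - j) - 1))" if "2 + 4 \<le> n" for n
  proof -
    have "25 * ebdf_tau 4 n - 23 * ebdf_tau 4 (n - 1) + 13 * ebdf_tau 4 (n - 2) - 3 * ebdf_tau 4 (n - 3) = 12"
      using ebdf_tau_4_conserved[of n] that by simp
    moreover have "25 * ebdf_tau 4 (n - 1) - 23 * ebdf_tau 4 (n - 2) + 13 * ebdf_tau 4 (n - 3) - 3 * ebdf_tau 4 (n - 4) = 12"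
      using ebdf_tau_4_conserved[of "n - 1"] that by (simp add: eval_nat_numeral)
    ultimately show ?thesis
      unfolding sum_1_to_numeral by (simp add: field_simps)
  qed
  show "\<bar>ebdf_tau 4 n - 1\<bar> < 1" if "2 \<le> n" "n < 2 + 4" for n
  proof -
    have v5: "ebdf_tau 4 5 = 10489968/9765625"
      using ebdf_tau_4_homogeneous[of 5] ebdf_tau_4_start by simp
    have "n = 2 \<or> n = 3 \<or> n = 4 \<or> n = 5" using that by linarith
    then show ?thesis using ebdf_tau_4_start v5 by auto
  qed
qed

lemma ebdf_tau_5_start:
  "ebdf_tau 5 0 = 0"
  "ebdf_tau 5 1 = 300/137"
  "ebdf_tau 5 2 = 7800/18769"
  "ebdf_tau 5 3 = 1271400/2571353"
  "ebdf_tau 5 4 = 415574100/352275361"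
  "ebdf_tau 5 5 = 64978409160/48261724457"
proof -
  note rec = ebdf_tau_rec[of 5, unfolded sum_1_to_numeral ebdf_coeffs_5]
  show v0: "ebdf_tau 5 0 = 0" using rec[of 0] ebdf_coeffs_5 by simp
  show v1: "ebdf_tau 5 1 = 300/137" using rec[of 1] v0 ebdf_coeffs_5 by simp
  show v2: "ebdf_tau 5 2 = 7800/18769" using rec[of 2] v0 v1 ebdf_coeffs_5 by simp
  show v3: "ebdf_tau 5 3 = 1271400/2571353" using rec[of 3] v0 v1 v2 ebdf_coeffs_5 by simp
  show v4: "ebdf_tau 5 4 = 415574100/352275361" using rec[of 4] v0 v1 v2 v3 ebdf_coeffs_5 by simp
  show v5: "ebdf_tau 5 5 = 64978409160/48261724457" using rec[of 5] v0 v1 v2 v3 v4 ebdf_coeffs_5 by simp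
qed

lemma ebdf_tau_5_homogeneous:
  assumes "6 \<le> n"
  shows "137 * ebdf_tau 5 n =
    300 * ebdf_tau 5 (n - 1) - 300 * ebdf_tau 5 (n - 2) + 200 * ebdf_tau 5 (n - 3) - 75 * ebdf_tau 5 (n - 4) + 12 * ebdf_tau 5 (n - 5)"
  using assms ebdf_tau_rec[of 5 n, unfolded sum_1_to_numeral ebdf_coeffs_5] by simp

lemma ebdf_tau_5_conserved:
  assumes "5 \<le> n"
  shows "137 * ebdf_tau 5 n - 163 * ebdf_tau 5 (n - 1) + 137 * ebdf_tau 5 (n - 2) - 63 * ebdf_tau 5 (n - 3) + 12 * ebdf_tau 5 (n - 4) = 60"
  using assms
proof (induction n rule: dec_induct)
  case base
  show ?case using ebdf_tau_5_start by simp
next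
  case (step n)
  have "Suc n - 2 = n - 1" "Suc n - 3 = n - 2" "Suc n - 4 = n - 3" "Suc n - 5 = n - 4" by simp_all
  then show ?case
    using step ebdf_tau_5_homogeneous[of "Suc n"] by simp
qed

text \<open>
  The multiplier \<open>2 + 2 z + z\<^sup>2\<close> is a rounding of twice the expansion \<open>1 + 1.19 z + 0.42 z\<^sup>2 + \<dots>\<close> of
  the reciprocal of \<open>1 - (163 z - 137 z\<^sup>2 + 63 z\<^sup>3 - 12 z\<^sup>4) / 137\<close>. A truncated reciprocal brings the
  product close to a constant, and this one lowers the absolute sum of the coefficients from \<open>375/137\<close> to \<open>238/274\<close>.
\<close>

lemma ebdf_tau_5_near_1:
  assumes "2 \<le> n"
  shows "\<bar>ebdf_tau 5 n - 1\<bar> < 1"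
proof (rule recurrence_preserves_abs_less_1[OF _ _ _ assms, where m = 6])
  let ?r = "(!) [0::real, 52/274, -85/274, 15/274, -35/274, 39/274, -12/274]"
  show "(\<Sum>j = 1..6. \<bar>?r j\<bar>) \<le> 1"
    unfolding sum_1_to_numeral by simp
  show "ebdf_tau 5 n - 1 = (\<Sum>j = 1..6. ?r j * (ebdf_tau 5 (n - j) - 1))" if "2 + 6 \<le> n" for n
  proof -
    have "137 * ebdf_tau 5 n - 163 * ebdf_tau 5 (n - 1) + 137 * ebdf_tau 5 (n - 2) - 63 * ebdf_tau 5 (n - 3) + 12 * ebdf_tau 5 (n - 4) = 60"
      using ebdf_tau_5_conserved[of n] that by simp
    moreover have "137 * ebdf_tau 5 (n - 1) - 163 * ebdf_tau 5 (n - 2) + 137 * ebdf_tau 5 (n - 3) - 63 * ebdf_tau 5 (n - 4) + 12 * ebdf_tau 5 (n - 5) = 60"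
      using ebdf_tau_5_conserved[of "n - 1"] that by (simp add: eval_nat_numeral)
    moreover have "137 * ebdf_tau 5 (n - 2) - 163 * ebdf_tau 5 (n - 3) + 137 * ebdf_tau 5 (n - 4) - 63 * ebdf_tau 5 (n - 5) + 12 * ebdf_tau 5 (n - 6) = 60"
      using ebdf_tau_5_conserved[of "n - 2"] that by (simp add: eval_nat_numeral)
    ultimately show ?thesis
      unfolding sum_1_to_numeral by (simp add: field_simps)
  qed
  show "\<bar>ebdf_tau 5 n - 1\<bar> < 1" if "2 \<le> n" "n < 2 + 6" for n
  proof -
    have v6: "ebdf_tau 5 6 = 6949958352600/6611856250609"
      using ebdf_tau_5_homogeneous[of 6] ebdf_tau_5_start by simp
    have v7: "ebdf_tau 5 7 = 762138554358600/905824306333433"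
      using ebdf_tau_5_homogeneous[of 7] ebdf_tau_5_start v6 by simp
    have "n = 2 \<or> n = 3 \<or> n = 4 \<or> n = 5 \<or> n = 6 \<or> n = 7" using that by linarith
    then show ?thesis using ebdf_tau_5_start v6 v7 by auto
  qed
qed

section \<open>Positivity\<close>

theorem theorem2p1:
  fixes k :: nat and \<tau> :: "int \<Rightarrow> real" and n\<^sub>0 :: int
  assumes "k \<in> {3, 4, 5}"
  defines "\<tau> \<equiv> lmm_tau k (ebdf_a k) (ebdf_b k)"
    and "n\<^sub>0 \<equiv> lmm_n0 k (ebdf_a k) (ebdf_b k)"
  shows "n\<^sub>0 = 1 \<and> (\<forall>n \<ge> n\<^sub>0. \<tau> n > 0)"
proof -
  have tau_nat: "\<tau> (int n) = ebdf_tau k n" for n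
    unfolding \<tau>_def ebdf_tau_def ..
  have pos_1: "ebdf_tau k 1 > 0"
    using assms(1) ebdf_tau_3_start(2) ebdf_tau_4_start(2) ebdf_tau_5_start(2) by auto
  have pos: "ebdf_tau k n > 0" if "1 \<le> n" for n
  proof (cases "n = 1")
    case False
    then have "\<bar>ebdf_tau k n - 1\<bar> < 1"
      using assms(1) that ebdf_tau_3_near_1 ebdf_tau_4_near_1 ebdf_tau_5_near_1 by auto
    then show ?thesis by linarith
  qed (use pos_1 in simp)
  have tau_pos: "\<tau> n > 0" if "1 \<le> n" for n
    using pos[of "nat n"] tau_nat[of "nat n"] that by simp
  have "n\<^sub>0 = 1"
    unfolding n\<^sub>0_def lmm_n0_def \<tau>_def[symmetric]
  proof (rule Min_eqI)
    show "finite {n. 1 \<le> n \<and> n \<le> int k \<and> \<tau> n \<noteq> 0}"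
      by (rule finite_subset[of _ "{1..int k}"]) auto
    show "1 \<in> {n. 1 \<le> n \<and> n \<le> int k \<and> \<tau> n \<noteq> 0}"
      using tau_pos[of 1] assms(1) by auto
  qed auto
  then show ?thesis using tau_pos by simp
qed

end
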